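(* Let $\mathbf{s}=(s_i)_{i\ge 1}$ be any sequence of positive integers and let $n$ be a positive integer. Then the $\mathbf{s}$-Eulerian polynomial $$E_n^{(\mathbf{s})}(x)=\sum_{\mathbf{e}\in \mathfrak{I}_n^{(\mathbf{s})}} x^{\operatorname{asc}\mathbf{e}}$$ has only real roots.
   Context: For a sequence $\mathbf{s}=(s_i)_{i\ge1}$ of positive integers, the set of $n$-dimensional $\mathbf{s}$-inversion sequences is $\mathfrak{I}_n^{(\mathbf{s})}=\{(e_1,\dots,e_n)\in\mathbb{Z}^n \mid 0\le e_i<s_i \text{ for } 1\le i\le n\}$. The ascent set of $\mathbf{e}=(e_1,\dots,e_n)\in\mathfrak{I}_n^{(\mathbf{s})}$ is $\operatorname{Asc}\mathbf{e}=\{i\in\{0,1,\dots,n-1\} \mid e_i/s_i<e_{i+1}/s_{i+1}\}$, with the convention $e_0=0$, $s_0=1$, and $\operatorname{asc}\mathbf{e}=|\operatorname{Asc}\mathbf{e}|$. A polynomial "has only real roots" if all its complex roots are real (nonzero constants qualify vacuously). *)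

theory Defs
  imports Complex_Main "HOL-Library.FuncSet" "HOL-Computational_Algebra.Polynomial"
begin

text \<open>
  A sequence \<open>(s\<^sub>i)\<close>, \<open>i \<ge> 1\<close>, is a function on \<^typ>\<open>nat\<close> whose value at \<open>0\<close> is irrelevant.
  An \<open>n\<close>-dimensional vector \<open>(e\<^sub>1, \<dots>, e\<^sub>n)\<close> is an extensional function on \<open>{1..n}\<close>, so that
  distinct elements of the set below correspond to distinct vectors.
\<close>

definition inversion_sequences :: "(nat \<Rightarrow> nat) \<Rightarrow> nat \<Rightarrow> (nat \<Rightarrow> int) set" where
  "inversion_sequences s n = (\<Pi>\<^sub>E i\<in>{1..n}. {e. 0 \<le> e \<and> e < int (s i)})"

text \<open>The updates at \<open>0\<close> implement the convention \<open>e\<^sub>0 = 0\<close>, \<open>s\<^sub>0 = 1\<close>.\<close>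

definition ascent_set :: "(nat \<Rightarrow> nat) \<Rightarrow> nat \<Rightarrow> (nat \<Rightarrow> int) \<Rightarrow> nat set" where
  "ascent_set s n e =
    (let e' = e(0 := 0); s' = s(0 := 1)
     in {i \<in> {0..<n}. real_of_int (e' i) / real (s' i)
                       < real_of_int (e' (i + 1)) / real (s' (i + 1))})"

definition asc :: "(nat \<Rightarrow> nat) \<Rightarrow> nat \<Rightarrow> (nat \<Rightarrow> int) \<Rightarrow> nat" where
  "asc s n e = card (ascent_set s n e)"

definition s_Eulerian_poly :: "(nat \<Rightarrow> nat) \<Rightarrow> nat \<Rightarrow> real poly" where
  "s_Eulerian_poly s n = (\<Sum>e\<in>inversion_sequences s n. monom 1 (asc s n e))"

text \<open>Nonzero constants satisfy this vacuously; the zero polynomial does not satisfy it.\<close>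

definition has_only_real_roots :: "real poly \<Rightarrow> bool" where
  "has_only_real_roots p \<longleftrightarrow>
    (\<forall>z::complex. poly (map_poly complex_of_real p) z = 0 \<longrightarrow> z \<in> \<real>)"

end

theory Submission
  imports Defs
begin

text \<open>
  Fix \<open>z\<close> in the open upper half plane and group the inversion sequences by their last entry:
  let \<open>V\<^sub>n h\<close> be the sum of \<open>z ^ asc e\<close> over those with \<open>e\<^sub>n = h\<close>. These numbers are nonzero and
  stay in angular order within a sector of opening \<open>arg z\<close>: the arguments of
  \<open>V\<^sub>n 0, \<dots>, V\<^sub>n (s\<^sub>n - 1), z * V\<^sub>n 0\<close> increase weakly. Extending the list by
  \<open>w\<^sub>k\<^sub>+\<^sub>N = z * w\<^sub>k\<close>, where \<open>N = s\<^sub>n\<close>, each \<open>V\<^sub>n\<^sub>+\<^sub>1 k\<close> is the sum over a window of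
  \<open>N\<close> consecutive \<open>w\<close>'s whose position increases with \<open>k\<close>, and therefore the order is inherited.
  Vectors in a sector of opening less than \<open>\<pi>\<close> have a nonzero sum, so \<open>E\<^sub>n\<close> does not vanish at
  \<open>z\<close>. Conjugation covers the lower half plane.
\<close>

text \<open>The planar cross product. For nonzero vectors it is nonnegative iff \<open>b\<close>
  lies counterclockwise from \<open>a\<close> by an angle in [0, \<pi>], so angular order can be
  handled without arguments and their branches.\<close>

definition cross :: "complex \<Rightarrow> complex \<Rightarrow> real" where
  "cross a b = Im (cnj a * b)"

lemma cross_add_left: "cross (a + b) c = cross a c + cross b c"
  and cross_add_right: "cross a (b + c) = cross a b + cross a c"
  and cross_zero_left: "cross 0 b = 0"
  and cross_self: "cross a a = 0"
  and cross_scale_both: "cross (z * a) (z * b) = (cmod z)\<^sup>2 * cross a b"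
  and cross_scale_right_self: "cross a (z * a) = Im z * (cmod a)\<^sup>2"
  unfolding cmod_power2 by (simp_all add: cross_def algebra_simps power2_eq_square)

lemma cross_sum_left: "cross (sum f A) b = (\<Sum>i\<in>A. cross (f i) b)"
  and cross_sum_right: "cross b (sum f A) = (\<Sum>i\<in>A. cross b (f i))"
  by (simp_all add: cross_def sum_distrib_left sum_distrib_right)

text \<open>All pairs are compared, not just neighbours: nonnegativity of \<open>cross\<close> is
  not transitive.\<close>

definition angular_order :: "complex \<Rightarrow> nat \<Rightarrow> (nat \<Rightarrow> complex) \<Rightarrow> bool" where
  "angular_order z N V \<longleftrightarrow>
    (\<forall>i<N. V i \<noteq> 0) \<and>
    (\<forall>i j. i \<le> j \<longrightarrow> j < N \<longrightarrow> 0 \<le> cross (V i) (V j) \<and> 0 \<le> cross (V j) (z * V i))"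

definition window_sum :: "complex \<Rightarrow> nat \<Rightarrow> (nat \<Rightarrow> complex) \<Rightarrow> nat \<Rightarrow> complex" where
  "window_sum z N V t = z * (\<Sum>h<t. V h) + (\<Sum>h\<in>{t..<N}. V h)"

text \<open>All vectors lie weakly on the clockwise side of \<open>z * V 0\<close>, and
  \<open>V 0\<close> lies strictly there, so they cannot cancel.\<close>

lemma angular_order_sum_nonzero:
  assumes "angular_order z N V" "0 < Im z" "0 < N"
  shows "(\<Sum>h<N. V h) \<noteq> 0"
proof -
  have "0 < cross (V 0) (z * V 0)"
    using assms by (simp add: cross_scale_right_self angular_order_def)
  also have "\<dots> \<le> (\<Sum>h<N. cross (V h) (z * V 0))"
    using assms by (intro member_le_sum) (auto simp: angular_order_def)
  finally have "0 < cross (\<Sum>h<N. V h) (z * V 0)"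
    by (simp add: cross_sum_left)
  then show ?thesis
    by (auto simp: cross_zero_left)
qed

text \<open>A window with \<open>t < N\<close> starts at \<open>V t\<close>, so it is tested against
  \<open>z * V t\<close>. At \<open>t = N\<close> it is \<open>z\<close> times the full sum.\<close>

lemma window_sum_nonzero:
  assumes V: "angular_order z N V" and z: "0 < Im z" and "0 < N" "t \<le> N"
  shows "window_sum z N V t \<noteq> 0"
proof (cases "t = N")
  case True
  then show ?thesis
    using angular_order_sum_nonzero[OF V z \<open>0 < N\<close>] z by (auto simp: window_sum_def)
next
  case False
  with \<open>t \<le> N\<close> have t: "t < N" by simp
  have "0 < cross (V t) (z * V t)"
    using V z t by (simp add: cross_scale_right_self angular_order_def)
  also have "\<dots> \<le> (\<Sum>h\<in>{t..<N}. cross (V h) (z * V t))"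
    using V t by (intro member_le_sum) (auto simp: angular_order_def)
  \<comment> \<open>The added terms come from the vectors \<open>z * V h\<close> with
    \<open>h < t\<close> at the end of the window.\<close>
  also have "\<dots> \<le> (cmod z)\<^sup>2 * (\<Sum>h<t. cross (V h) (V t)) + \<dots>"
    using V t by (auto simp: angular_order_def intro!: mult_nonneg_nonneg sum_nonneg)
  also have "\<dots> = cross (window_sum z N V t) (z * V t)"
    by (simp add: window_sum_def cross_add_left cross_scale_both cross_sum_left)
  finally show ?thesis
    by (auto simp: cross_zero_left)
qed

text \<open>Moving the window from \<open>t\<close> to \<open>u\<close> replaces a block
  \<open>B\<close> by \<open>z * B\<close>. The common part lies in angle between \<open>B\<close>
  and \<open>z * B\<close>, so bilinearity leaves only nonnegative terms.\<close>

lemma window_sum_cross_nonneg: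
  assumes V: "angular_order z N V" and z: "0 < Im z" and "t \<le> u" "u \<le> N"
  shows "0 \<le> cross (window_sum z N V t) (window_sum z N V u)"
    and "0 \<le> cross (window_sum z N V u) (z * window_sum z N V t)"
proof -
  define A B C where "A = (\<Sum>h<t. V h)" and "B = (\<Sum>h\<in>{t..<u}. V h)" and "C = (\<Sum>h\<in>{u..<N}. V h)"
  define D where "D = C + z * A"
  have "(\<Sum>h<u. V h) = A + B"
    using \<open>t \<le> u\<close> by (simp add: A_def B_def lessThan_atLeast0 sum.atLeastLessThan_concat)
  moreover have "(\<Sum>h\<in>{t..<N}. V h) = B + C"
    using \<open>t \<le> u\<close> \<open>u \<le> N\<close> by (simp add: B_def C_def sum.atLeastLessThan_concat)
  \<comment> \<open>\<open>D\<close> is the part common to the windows at \<open>t\<close> and \<open>u\<close>.\<close>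
  ultimately have Ft: "window_sum z N V t = B + D" and Fu: "window_sum z N V u = D + z * B"
    by (simp_all add: window_sum_def D_def A_def[symmetric] C_def[symmetric] algebra_simps)
  have AB: "0 \<le> cross A B" and BC: "0 \<le> cross B C"
    and CB: "0 \<le> cross C (z * B)" and BA: "0 \<le> cross B (z * A)"
    using V \<open>t \<le> u\<close> \<open>u \<le> N\<close> unfolding A_def B_def C_def angular_order_def
    by (auto simp: cross_sum_left cross_sum_right sum_distrib_left intro!: sum_nonneg)
  have BD: "0 \<le> cross B D"
    using BC BA by (simp add: D_def cross_add_right)
  have DB: "0 \<le> cross D (z * B)"
    using CB AB by (simp add: D_def cross_add_left cross_scale_both)
  show "0 \<le> cross (window_sum z N V t) (window_sum z N V u)"
    using BD DB z by (simp add: Ft Fu cross_add_left cross_add_right cross_self cross_scale_right_self)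
  show "0 \<le> cross (window_sum z N V u) (z * window_sum z N V t)"
    using BD DB z
    by (simp add: Ft Fu distrib_left cross_add_left cross_add_right cross_self cross_scale_right_self
        cross_scale_both)
qed

lemma angular_order_window_sum:
  assumes "angular_order z N V" "0 < Im z" "0 < N"
    and "\<And>k. k < M \<Longrightarrow> t k \<le> N" and "\<And>k l. k \<le> l \<Longrightarrow> l < M \<Longrightarrow> t k \<le> t l"
  shows "angular_order z M (\<lambda>k. window_sum z N V (t k))"
  unfolding angular_order_def
  using assms by (simp add: window_sum_nonzero window_sum_cross_nonneg)

text \<open>When \<open>s 0 = 1\<close>, the recursion reads the base value only at
  \<open>0\<close>, the conventional last entry of the empty sequence.\<close>

fun last_entry_sum :: "complex \<Rightarrow> (nat \<Rightarrow> nat) \<Rightarrow> nat \<Rightarrow> nat \<Rightarrow> complex" where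
  "last_entry_sum z s 0 k = 1"
| "last_entry_sum z s (Suc n) k =
    (\<Sum>h<s n. (if real h / real (s n) < real k / real (s (Suc n)) then z else 1)
      * last_entry_sum z s n h)"

text \<open>For fixed \<open>k\<close>, the previous entries \<open>h\<close> that give an ascent
  form an initial segment. Clearing denominators and rounding up gives its length
  \<open>t\<close>.\<close>

lemma last_entry_sum_Suc:
  assumes "0 < s n" "0 < s (Suc n)" "k < s (Suc n)"
  defines "t \<equiv> nat \<lceil>real k * real (s n) / real (s (Suc n))\<rceil>"
  shows "last_entry_sum z s (Suc n) k = window_sum z (s n) (last_entry_sum z s n) t"
    and "t \<le> s n"
proof -
  have "real k * real (s n) / real (s (Suc n)) \<le> real (s n)"
    using assms by (simp add: divide_simps mult.commute mult_left_mono)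
  then show t: "t \<le> s n"
    by (simp add: t_def nat_le_iff ceiling_le_iff)
  have iff: "real h / real (s n) < real k / real (s (Suc n)) \<longleftrightarrow> h < t" for h
  proof -
    have "real h / real (s n) < real k / real (s (Suc n)) \<longleftrightarrow>
        real h < real k * real (s n) / real (s (Suc n))"
      using assms by (simp add: field_simps)
    then show ?thesis
      by (simp add: t_def zless_nat_eq_int_zless less_ceiling_iff)
  qed
  have "last_entry_sum z s (Suc n) k =
      (\<Sum>h<t. (if h < t then z else 1) * last_entry_sum z s n h) +
      (\<Sum>h\<in>{t..<s n}. (if h < t then z else 1) * last_entry_sum z s n h)"
    using t unfolding last_entry_sum.simps iff
    by (simp only: lessThan_atLeast0 sum.atLeastLessThan_concat)
  then show "last_entry_sum z s (Suc n) k = window_sum z (s n) (last_entry_sum z s n) t"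
    by (simp add: window_sum_def sum_distrib_left)
qed

lemma angular_order_last_entry_sum:
  assumes s: "\<And>i. 0 < s i" and "s 0 = 1" and z: "0 < Im z"
  shows "angular_order z (s n) (last_entry_sum z s n)"
proof (induction n)
  case 0
  then show ?case
    using \<open>s 0 = 1\<close> z by (simp add: angular_order_def cross_def)
next
  case (Suc n)
  define t where "t k = nat \<lceil>real k * real (s n) / real (s (Suc n))\<rceil>" for k
  have "angular_order z (s (Suc n)) (\<lambda>k. window_sum z (s n) (last_entry_sum z s n) (t k))"
  proof (rule angular_order_window_sum[OF Suc z s])
    show "t k \<le> s n" if "k < s (Suc n)" for k
      using last_entry_sum_Suc(2)[of s n k, OF s s that] by (simp add: t_def)
    \<comment> \<open>A larger last entry turns more previous entries into ascents, so the window
      only moves forward.\<close>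
    show "t k \<le> t l" if "k \<le> l" for k l
      unfolding t_def using that
      by (intro nat_mono ceiling_mono divide_right_mono mult_right_mono) auto
  qed
  then show ?case
    using last_entry_sum_Suc(1)[of s n, OF s s] by (simp add: angular_order_def t_def)
qed

lemma sum_inversion_sequences_Suc:
  "(\<Sum>e\<in>inversion_sequences s (Suc n). f e) =
    (\<Sum>y<s (Suc n). \<Sum>e\<in>inversion_sequences s n. f (e(Suc n := int y)))"
proof -
  let ?Y = "{y. 0 \<le> y \<and> y < int (s (Suc n))}"
  have ins: "inversion_sequences s (Suc n) =
      (\<lambda>(y, e). e(Suc n := y)) ` (?Y \<times> inversion_sequences s n)"
    unfolding inversion_sequences_def by (simp add: atLeastAtMostSuc_conv PiE_insert_eq)
  have inj: "inj_on (\<lambda>(y, e). e(Suc n := y)) (?Y \<times> inversion_sequences s n)"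
    unfolding inversion_sequences_def by (rule inj_combinator) simp
  have "(\<Sum>e\<in>inversion_sequences s (Suc n). f e) =
      (\<Sum>y\<in>?Y. \<Sum>e\<in>inversion_sequences s n. f (e(Suc n := y)))"
    unfolding ins sum.reindex[OF inj] sum.cartesian_product by (simp add: case_prod_beta comp_def)
  also have "?Y = int ` {..<s (Suc n)}"
    using image_int_atLeastLessThan[of 0 "s (Suc n)"]
    by (auto simp: lessThan_atLeast0)
  finally show ?thesis
    unfolding sum.reindex[OF inj_on_of_nat] comp_def .
qed

lemma asc_fun_upd_Suc:
  "asc s (Suc n) (e(Suc n := y)) = asc s n e +
    (if real_of_int ((e(0 := 0)) n) / real ((s(0 := 1)) n) < real_of_int y / real (s (Suc n))
     then 1 else 0)"
proof -
  have "ascent_set s (Suc n) (e(Suc n := y)) = ascent_set s n e \<union>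
    (if real_of_int ((e(0 := 0)) n) / real ((s(0 := 1)) n) < real_of_int y / real (s (Suc n))
     then {n} else {})"
    by (auto simp: ascent_set_def Let_def less_Suc_eq)
  moreover have "finite (ascent_set s n e)" "n \<notin> ascent_set s n e"
    by (auto simp: ascent_set_def Let_def)
  ultimately show ?thesis
    by (simp add: asc_def)
qed

text \<open>The weight \<open>g\<close> lets the induction absorb the factor for a possible ascent at the last position.\<close>

lemma sum_power_asc:
  fixes z :: complex
  shows "(\<Sum>e\<in>inversion_sequences s n. z ^ asc s n e * g ((e(0 := 0)) n)) =
    (\<Sum>h<(s(0 := 1)) n. last_entry_sum z (s(0 := 1)) n h * g (int h))"
proof (induction n arbitrary: g)
  case 0
  then show ?case
    by (simp add: inversion_sequences_def asc_def ascent_set_def)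
next
  case (Suc n)
  let ?w = "\<lambda>x y. if real_of_int x / real ((s(0 := 1)) n) < real y / real (s (Suc n)) then z else 1"
  have "(\<Sum>e\<in>inversion_sequences s (Suc n). z ^ asc s (Suc n) e * g ((e(0 := 0)) (Suc n))) =
      (\<Sum>y<s (Suc n). \<Sum>e\<in>inversion_sequences s n.
        z ^ asc s n e * (?w ((e(0 := 0)) n) y * g (int y)))"
    unfolding sum_inversion_sequences_Suc asc_fun_upd_Suc
    by (intro sum.cong refl) simp
  also have "\<dots> = (\<Sum>y<s (Suc n). \<Sum>h<(s(0 := 1)) n.
        last_entry_sum z (s(0 := 1)) n h * (?w (int h) y * g (int y)))"
    by (intro sum.cong refl Suc.IH)
  also have "\<dots> = (\<Sum>y<(s(0 := 1)) (Suc n). last_entry_sum z (s(0 := 1)) (Suc n) y * g (int y))"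
    by (simp add: sum_distrib_right sum_distrib_left mult_ac fun_upd_other[of "Suc n" 0] del: fun_upd_apply)
  finally show ?case .
qed

lemma poly_s_Eulerian_poly:
  "poly (map_poly complex_of_real (s_Eulerian_poly s n)) z =
    (\<Sum>e\<in>inversion_sequences s n. z ^ asc s n e)"
proof -
  have "map_poly complex_of_real (s_Eulerian_poly s n) =
      (\<Sum>e\<in>inversion_sequences s n. monom 1 (asc s n e))"
    by (intro poly_eqI) (simp add: s_Eulerian_poly_def coeff_map_poly coeff_sum if_distrib cong: if_cong)
  then show ?thesis
    by (simp add: poly_sum poly_monom)
qed

lemma sum_power_asc_nonzero:
  fixes z :: complex
  assumes "\<And>i. i \<ge> 1 \<Longrightarrow> s i > 0" and "0 < Im z"
  shows "(\<Sum>e\<in>inversion_sequences s n. z ^ asc s n e) \<noteq> 0"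
proof -
  \<comment> \<open>The value \<open>s 0\<close> is arbitrary, so the convention is imposed before
    the recursion is used.\<close>
  let ?s = "s(0 := 1)"
  have pos: "0 < ?s i" for i
    using assms(1)[of i] by simp
  have "(\<Sum>h<?s n. last_entry_sum z ?s n h) \<noteq> 0"
    by (rule angular_order_sum_nonzero[OF angular_order_last_entry_sum[OF pos _ assms(2)] assms(2) pos])
      simp
  then show ?thesis
    using sum_power_asc[of z s n "\<lambda>_. 1"] by simp
qed

theorem theorem1p1:
  fixes s :: "nat \<Rightarrow> nat" and n :: nat
  assumes "\<And>i. i \<ge> 1 \<Longrightarrow> s i > 0"
    and "n \<ge> 1"
  shows "has_only_real_roots (s_Eulerian_poly s n)"
  unfolding has_only_real_roots_def poly_s_Eulerian_poly
proof (intro allI impI)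
  fix z :: complex
  assume root: "(\<Sum>e\<in>inversion_sequences s n. z ^ asc s n e) = 0"
  then have "cnj (\<Sum>e\<in>inversion_sequences s n. z ^ asc s n e) = 0"
    by simp
  then have "(\<Sum>e\<in>inversion_sequences s n. cnj z ^ asc s n e) = 0"
    by simp
  with root have "\<not> 0 < Im z" "\<not> 0 < Im (cnj z)"
    using sum_power_asc_nonzero[of s, OF assms(1)] by blast+
  then show "z \<in> \<real>"
    by (simp add: complex_is_Real_iff)
qed

end
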